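(* Suppose there exist $m$ mutually orthogonal Latin squares of order $n$. Then there exists a resolvable semi-regular STD$(n)$ rectangular design with parameters $v=mn$, $b=n(n-1)$, $r=n-1$, $k=m$, $\lambda_1=\lambda_2=0$, $\lambda_3=1$, $m$, $n$.
   Context: A Latin square of order $n$ is an $n\times n$ array on $n$ symbols with each symbol exactly once in each row and column; two are orthogonal if superimposing them yields every ordered pair of symbols exactly once; a set is mutually orthogonal if pairwise orthogonal. A rectangular design (RD) with parameters $v=mn,b,r,k,\lambda_1,\lambda_2,\lambda_3,m,n$ has its treatments arranged in an $m\times n$ array, $b$ blocks of size $k$, replication $r$, and any two distinct treatments occur together in $\lambda_1$ blocks if in the same row, $\lambda_2$ if in the same column, $\lambda_3$ otherwise. With $\theta_1=r-\lambda_1+(m-1)(\lambda_2-\lambda_3)$, $\theta_2=r-\lambda_2+(n-1)(\lambda_1-\lambda_3)$, $\theta_3=r-\lambda_1-\lambda_2+\lambda_3$, the RD is semi-regular if exactly one of $\theta_1,\theta_2$ is $0$ and the other two $\theta$'s are positive. It is STD$(n)$ if its incidence matrix (rows grouped by rows of the array) is partitioned into $n\times n$ submatrices each having constant row sums and constant column sums. It is resolvable if the blocks can be partitioned into classes each containing every treatment exactly once.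
   Formalization: The order n is assumed to be at least 2; for n = 1 the claim fails (with m = n = 1 both θ1 and θ2 are 0, and for m ≥ 2 θ1 = 1 − m is negative), so no semi-regular design with these parameters exists. *)

theory Defs
  imports "HOL-Library.Multiset"
begin

text \<open>An \<open>n \<times> n\<close> array is a function of the row and column index, relevant for indices below \<open>n\<close>.
  The symbol set of a square is not fixed in advance, and different squares may use
  different symbols.\<close>

definition symbols :: "nat \<Rightarrow> (nat \<Rightarrow> nat \<Rightarrow> 'a) \<Rightarrow> 'a set" where
  "symbols n L = {L i j | i j. i < n \<and> j < n}"

definition latin_square :: "nat \<Rightarrow> (nat \<Rightarrow> nat \<Rightarrow> 'a) \<Rightarrow> bool" where
  "latin_square n L \<longleftrightarrow>
     card (symbols n L) = n \<and>
     (\<forall>i<n. \<forall>x\<in>symbols n L. \<exists>!j. j < n \<and> L i j = x) \<and>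
     (\<forall>j<n. \<forall>x\<in>symbols n L. \<exists>!i. i < n \<and> L i j = x)"

definition orthogonal_squares :: "nat \<Rightarrow> (nat \<Rightarrow> nat \<Rightarrow> 'a) \<Rightarrow> (nat \<Rightarrow> nat \<Rightarrow> 'a) \<Rightarrow> bool" where
  "orthogonal_squares n L L' \<longleftrightarrow>
     (\<forall>x\<in>symbols n L. \<forall>y\<in>symbols n L'.
        \<exists>!p. fst p < n \<and> snd p < n \<and> L (fst p) (snd p) = x \<and> L' (fst p) (snd p) = y)"

definition mols :: "nat \<Rightarrow> nat \<Rightarrow> (nat \<Rightarrow> nat \<Rightarrow> nat \<Rightarrow> 'a) \<Rightarrow> bool" where
  "mols m n L \<longleftrightarrow>
     (\<forall>l<m. latin_square n (L l)) \<and>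
     (\<forall>l<m. \<forall>l'<m. l \<noteq> l' \<longrightarrow> orthogonal_squares n (L l) (L l'))"

text \<open>A treatment is identified with its position (row, column) in the \<open>m \<times> n\<close> array.
  The blocks form a multiset, since repeated blocks are allowed.\<close>

definition treatments :: "nat \<Rightarrow> nat \<Rightarrow> (nat \<times> nat) set" where
  "treatments m n = {..<m} \<times> {..<n}"

definition replication :: "(nat \<times> nat) set multiset \<Rightarrow> nat \<times> nat \<Rightarrow> nat" where
  "replication \<B> x = size {#B \<in># \<B>. x \<in> B#}"

definition concurrence :: "(nat \<times> nat) set multiset \<Rightarrow> nat \<times> nat \<Rightarrow> nat \<times> nat \<Rightarrow> nat" where
  "concurrence \<B> x y = size {#B \<in># \<B>. x \<in> B \<and> y \<in> B#}"

definition rectangular_design ::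
  "nat \<Rightarrow> nat \<Rightarrow> nat \<Rightarrow> nat \<Rightarrow> nat \<Rightarrow> nat \<Rightarrow> nat \<Rightarrow> nat \<Rightarrow> nat \<Rightarrow> (nat \<times> nat) set multiset \<Rightarrow> bool" where
  "rectangular_design v b r k l1 l2 l3 m n \<B> \<longleftrightarrow>
     card (treatments m n) = v \<and>
     size \<B> = b \<and>
     (\<forall>B\<in>#\<B>. B \<subseteq> treatments m n \<and> card B = k) \<and>
     (\<forall>x\<in>treatments m n. replication \<B> x = r) \<and>
     (\<forall>x\<in>treatments m n. \<forall>y\<in>treatments m n. x \<noteq> y \<longrightarrow>
        concurrence \<B> x y =
          (if fst x = fst y then l1 else if snd x = snd y then l2 else l3))"

definition theta1 :: "nat \<Rightarrow> nat \<Rightarrow> nat \<Rightarrow> nat \<Rightarrow> nat \<Rightarrow> nat \<Rightarrow> int" where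
  "theta1 r l1 l2 l3 m n = int r - int l1 + (int m - 1) * (int l2 - int l3)"

definition theta2 :: "nat \<Rightarrow> nat \<Rightarrow> nat \<Rightarrow> nat \<Rightarrow> nat \<Rightarrow> nat \<Rightarrow> int" where
  "theta2 r l1 l2 l3 m n = int r - int l2 + (int n - 1) * (int l1 - int l3)"

definition theta3 :: "nat \<Rightarrow> nat \<Rightarrow> nat \<Rightarrow> nat \<Rightarrow> nat \<Rightarrow> nat \<Rightarrow> int" where
  "theta3 r l1 l2 l3 m n = int r - int l1 - int l2 + int l3"

definition semi_regular :: "nat \<Rightarrow> nat \<Rightarrow> nat \<Rightarrow> nat \<Rightarrow> nat \<Rightarrow> nat \<Rightarrow> bool" where
  "semi_regular r l1 l2 l3 m n \<longleftrightarrow>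
     (theta1 r l1 l2 l3 m n = 0 \<and> theta2 r l1 l2 l3 m n > 0 \<and> theta3 r l1 l2 l3 m n > 0) \<or>
     (theta2 r l1 l2 l3 m n = 0 \<and> theta1 r l1 l2 l3 m n > 0 \<and> theta3 r l1 l2 l3 m n > 0)"

text \<open>The incidence matrix for the block order given by the list \<open>bs\<close>. Its rows are grouped by
  the rows of the treatment array: row \<open>i * n + j\<close> (with \<open>j < n\<close>) belongs to treatment \<open>(i, j)\<close>.\<close>

definition incidence_matrix :: "nat \<Rightarrow> (nat \<times> nat) set list \<Rightarrow> nat \<Rightarrow> nat \<Rightarrow> nat" where
  "incidence_matrix n bs p q = of_bool ((p div n, p mod n) \<in> bs ! q)"

definition submatrix :: "nat \<Rightarrow> (nat \<Rightarrow> nat \<Rightarrow> nat) \<Rightarrow> nat \<Rightarrow> nat \<Rightarrow> nat \<Rightarrow> nat \<Rightarrow> nat" where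
  "submatrix n N g h s t = N (g * n + s) (h * n + t)"

definition constant_row_sums :: "nat \<Rightarrow> (nat \<Rightarrow> nat \<Rightarrow> nat) \<Rightarrow> bool" where
  "constant_row_sums n M \<longleftrightarrow> (\<exists>c. \<forall>s<n. (\<Sum>t<n. M s t) = c)"

definition constant_column_sums :: "nat \<Rightarrow> (nat \<Rightarrow> nat \<Rightarrow> nat) \<Rightarrow> bool" where
  "constant_column_sums n M \<longleftrightarrow> (\<exists>c. \<forall>t<n. (\<Sum>s<n. M s t) = c)"

text \<open>The order of the blocks is not part of a design, so \<open>STD(n)\<close> asks for some block order
  whose incidence matrix splits into \<open>n \<times> n\<close> submatrices as required. The constants may depend
  on the submatrix.\<close>

definition STD :: "nat \<Rightarrow> nat \<Rightarrow> (nat \<times> nat) set multiset \<Rightarrow> bool" where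
  "STD m n \<B> \<longleftrightarrow>
     (\<exists>bs. mset bs = \<B> \<and> n dvd length bs \<and>
        (\<forall>g<m. \<forall>h<length bs div n.
           constant_row_sums n (submatrix n (incidence_matrix n bs) g h) \<and>
           constant_column_sums n (submatrix n (incidence_matrix n bs) g h)))"

definition resolvable :: "nat \<Rightarrow> nat \<Rightarrow> (nat \<times> nat) set multiset \<Rightarrow> bool" where
  "resolvable m n \<B> \<longleftrightarrow>
     (\<exists>\<C>. sum_mset \<C> = \<B> \<and>
        (\<forall>C\<in>#\<C>. C \<noteq> {#} \<and> (\<forall>x\<in>treatments m n. replication C x = 1)))"

end

theory Submission
  imports Defs
begin

text \<open>Rename the symbols of each square so that its first row reads \<open>0, \<dots>, n - 1\<close>, and let the
  cell \<open>(i, j)\<close> outside the first row give the block \<open>{(l, f l i j) | l < m}\<close>. Two squares show the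
  pair \<open>(c, d)\<close> in exactly one cell, and this cell lies in the deleted first row iff \<open>c = d\<close>: this
  gives \<open>\<lambda>\<^sub>2 = 0\<close> and \<open>\<lambda>\<^sub>3 = 1\<close>. The blocks of one row of the squares form a resolution class, and
  their incidence matrix splits into permutation matrices. Semi-regularity amounts to \<open>m < n\<close>,
  which holds because the entries \<open>f l 1 0\<close> are distinct and nonzero.\<close>

locale normalised_mols =
  fixes m n :: nat and f :: "nat \<Rightarrow> nat \<Rightarrow> nat \<Rightarrow> nat"
  assumes two_le: "2 \<le> n"
    and entry_less: "\<lbrakk>l < m; i < n; j < n\<rbrakk> \<Longrightarrow> f l i j < n"
    and first_row: "\<lbrakk>l < m; c < n\<rbrakk> \<Longrightarrow> f l 0 c = c"
    and row_latin: "\<lbrakk>l < m; i < n; c < n\<rbrakk> \<Longrightarrow> \<exists>!j. j < n \<and> f l i j = c"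
    and column_latin: "\<lbrakk>l < m; j < n; c < n\<rbrakk> \<Longrightarrow> \<exists>!i. i < n \<and> f l i j = c"
    and orthogonal: "\<lbrakk>l < m; l' < m; l \<noteq> l'; c < n; d < n\<rbrakk> \<Longrightarrow>
      \<exists>!p. fst p < n \<and> snd p < n \<and> f l (fst p) (snd p) = c \<and> f l' (fst p) (snd p) = d"

section \<open>Normalising the symbols of the squares\<close>

text \<open>Being Latin or orthogonal depends only on which entries of a square coincide, so each
  square may be relabelled separately.\<close>

lemma mols_normalise:
  assumes L: "mols m n L" and n: "2 \<le> n"
  shows "\<exists>f. normalised_mols m n f"
proof -
  \<comment> \<open>The new name of a symbol is the column in which row 0 of the same square shows
    it.\<close>
  define f where "f l i j = (THE c. c < n \<and> L l 0 c = L l i j)" for l i j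
  have sym: "L l i j \<in> symbols n (L l)" if "i < n" "j < n" for l i j
    using that by (auto simp: symbols_def)
  have sym0: "L l 0 c \<in> symbols n (L l)" if "c < n" for l c
    using sym[of 0 c l] that n by simp
  have latin: "latin_square n (L l)" if "l < m" for l
    using L that by (auto simp: mols_def)
  have row: "\<exists>!j. j < n \<and> L l i j = x" if "l < m" "i < n" "x \<in> symbols n (L l)" for l i x
    using latin[OF that(1)] that unfolding latin_square_def by blast
  have col: "\<exists>!i. i < n \<and> L l i j = x" if "l < m" "j < n" "x \<in> symbols n (L l)" for l j x
    using latin[OF that(1)] that unfolding latin_square_def by blast
  have uniq: "\<exists>!c. c < n \<and> L l 0 c = L l i j" if "l < m" "i < n" "j < n" for l i j
    using row[of l 0 "L l i j"] sym that n by simp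
  have f_spec: "f l i j < n \<and> L l 0 (f l i j) = L l i j" if "l < m" "i < n" "j < n" for l i j
    unfolding f_def by (rule theI'[OF uniq[OF that]])
  \<comment> \<open>Every Latin and orthogonality condition on \<open>f\<close> turns into one on
    \<open>L\<close> by this rewriting; \<open>conj_cong\<close> supplies the bounds it
    needs.\<close>
  have f_eq: "f l i j = c \<longleftrightarrow> L l i j = L l 0 c" if "l < m" "i < n" "j < n" "c < n" for l i j c
    using uniq[OF that(1-3)] f_spec[OF that(1-3)] that(4) by metis
  have "normalised_mols m n f"
  proof (rule normalised_mols.intro)
    show "2 \<le> n" by (rule n)
    show "f l i j < n" if "l < m" "i < n" "j < n" for l i j
      using f_spec that by blast
    show "f l 0 c = c" if "l < m" "c < n" for l c
      using f_eq[of l 0 c c] that n by simp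
    show "\<exists>!j. j < n \<and> f l i j = c" if "l < m" "i < n" "c < n" for l i c
      using row[OF that(1,2) sym0[OF that(3)]] f_eq[OF that(1,2) _ that(3)]
      by (simp cong: conj_cong)
    show "\<exists>!i. i < n \<and> f l i j = c" if "l < m" "j < n" "c < n" for l j c
      using col[OF that(1,2) sym0[OF that(3)]] f_eq[OF that(1) _ that(2,3)]
      by (simp cong: conj_cong)
    show "\<exists>!p. fst p < n \<and> snd p < n \<and> f l (fst p) (snd p) = c \<and> f l' (fst p) (snd p) = d"
      if "l < m" "l' < m" "l \<noteq> l'" "c < n" "d < n" for l l' c d
    proof -
      have "orthogonal_squares n (L l) (L l')"
        using L that by (auto simp: mols_def)
      then have "\<exists>!p. fst p < n \<and> snd p < n \<and> L l (fst p) (snd p) = L l 0 c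
          \<and> L l' (fst p) (snd p) = L l' 0 d"
        unfolding orthogonal_squares_def using sym0 that by blast
      then show ?thesis
        using f_eq that by (simp cong: conj_cong)
    qed
  qed
  then show ?thesis by blast
qed

text \<open>The range falls into \<open>k\<close> runs of length \<open>n\<close>; in run
  \<open>h\<close> the quotient stays \<open>h\<close> while the remainder sweeps
  \<open>{..<n}\<close>. This links a linear order of the blocks, as \<open>STD\<close> wants it, to
  their sum over rows.\<close>

lemma mset_map_div_mod:
  "mset (map (\<lambda>q. g (q div n) (q mod n)) [0..<k * n]) =
     (\<Sum>h<k. image_mset (g h) (mset_set {..<n}))"
proof (cases "n = 0")
  case True
  then show ?thesis by simp
next
  case False
  show ?thesis
  proof (induction k)
    case 0
    then show ?case by simp
  next
    case (Suc k)
    have "[0..<Suc k * n] = [0..<k * n] @ map (\<lambda>t. t + k * n) [0..<n]"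
      using upt_add_eq_append[of 0 "k * n" n] by (simp add: map_add_upt add.commute)
    moreover have "image_mset ((\<lambda>q. g (q div n) (q mod n)) \<circ> (\<lambda>t. t + k * n)) (mset_set {0..<n}) =
        image_mset (g k) (mset_set {0..<n})"
      using False by (intro image_mset_cong) auto
    ultimately show ?case
      using Suc.IH by (simp add: lessThan_atLeast0)
  qed
qed

lemma card_eq_1_of_ex1: "\<exists>!x. P x \<Longrightarrow> card {x. P x} = 1"
  by (auto simp: card_1_singleton_iff)

section \<open>The design and its parameters\<close>

context normalised_mols
begin

definition block :: "nat \<Rightarrow> nat \<Rightarrow> (nat \<times> nat) set" where
  "block i j = {(l, f l i j) | l. l < m}"

text \<open>Multisets are essential: for \<open>m \<le> 1\<close> different cells may give the same
  block.\<close>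

definition row_class :: "nat \<Rightarrow> (nat \<times> nat) set multiset" where
  "row_class i = image_mset (block i) (mset_set {..<n})"

text \<open>The shift by \<open>Suc\<close> skips row 0, whose blocks would be the columns of the
  treatment array.\<close>

definition blocks :: "(nat \<times> nat) set multiset" where
  "blocks = (\<Sum>h<n - 1. row_class (Suc h))"

lemma mem_block_iff: "(l, c) \<in> block i j \<longleftrightarrow> l < m \<and> f l i j = c"
  by (auto simp: block_def)

lemma card_block: "card (block i j) = m"
proof -
  have "block i j = (\<lambda>l. (l, f l i j)) ` {..<m}"
    by (auto simp: block_def)
  then show ?thesis
    by (simp add: card_image inj_on_def)
qed

lemma size_filter_row_class: "size {#B \<in># row_class i. P B#} = card {j. j < n \<and> P (block i j)}"
  by (simp add: row_class_def filter_mset_image_mset)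

lemma size_filter_blocks:
  "size {#B \<in># blocks. P B#} = (\<Sum>h<n - 1. card {j. j < n \<and> P (block (Suc h) j)})"
proof -
  have "size {#B \<in># (\<Sum>h<k. row_class (Suc h)). P B#} =
      (\<Sum>h<k. card {j. j < n \<and> P (block (Suc h) j)})" for k
    by (induction k) (simp_all add: size_filter_row_class)
  then show ?thesis
    by (simp add: blocks_def)
qed

lemma card_row_entry: "\<lbrakk>l < m; i < n; c < n\<rbrakk> \<Longrightarrow> card {j. j < n \<and> f l i j = c} = 1"
  using card_eq_1_of_ex1[OF row_latin] .

lemma replication_row_class:
  assumes "x \<in> treatments m n" "i < n"
  shows "replication (row_class i) x = 1"
  using assms card_row_entry[of "fst x" i "snd x"]
  by (cases x) (simp add: replication_def size_filter_row_class mem_block_iff treatments_def)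

lemma replication_blocks:
  assumes "x \<in> treatments m n"
  shows "replication blocks x = n - 1"
proof -
  have "replication blocks x = (\<Sum>h<n - 1. replication (row_class (Suc h)) x)"
    by (simp add: replication_def size_filter_row_class size_filter_blocks)
  also have "\<dots> = (\<Sum>h<n - 1. 1)"
    using assms by (intro sum.cong) (auto intro: replication_row_class[unfolded One_nat_def])
  finally show ?thesis by simp
qed

lemma concurrence_same_row:
  assumes "c \<noteq> d"
  shows "concurrence blocks (l, c) (l, d) = 0"
  using assms by (auto simp: concurrence_def size_filter_blocks mem_block_iff)

lemma concurrence_other_row:
  assumes "l < m" "l' < m" "l \<noteq> l'" "c < n" "d < n"
  shows "concurrence blocks (l, c) (l', d) = (if c = d then 0 else 1)"
proof -
  let ?P = "\<lambda>p. fst p < n \<and> snd p < n \<and> f l (fst p) (snd p) = c \<and> f l' (fst p) (snd p) = d"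
  \<comment> \<open>Up to the shift by one row, \<open>?S\<close> is the set of cells outside row 0
    that show the pair \<open>(c, d)\<close>.\<close>
  let ?S = "SIGMA h:{..<n - 1}. {j. j < n \<and> f l (Suc h) j = c \<and> f l' (Suc h) j = d}"
  have conc: "concurrence blocks (l, c) (l', d) = card ?S"
    using assms by (simp add: concurrence_def size_filter_blocks mem_block_iff)
  obtain p where p: "?P p" and unique: "\<And>q. ?P q \<Longrightarrow> q = p"
    using orthogonal[OF assms] by blast
  show ?thesis
  proof (cases "c = d")
    case True
    then have "p = (0, c)"
      using unique[of "(0, c)"] assms first_row by auto
    \<comment> \<open>Shifted back, a member of \<open>?S\<close> would be a second cell with this
      pair.\<close>
    then have "q \<notin> ?S" for q
      using unique[of "(Suc (fst q), snd q)"] by (cases q) (auto simp: less_diff_conv)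
    then have "?S = {}"
      by blast
    then have "card ?S = 0"
      by (simp only: card.empty)
    then show ?thesis
      using conc True by simp
  next
    case False
    \<comment> \<open>In row 0 the two squares agree in every column.\<close>
    then have "fst p \<noteq> 0"
      using p assms first_row by metis
    then obtain h where h: "fst p = Suc h"
      using not0_implies_Suc by blast
    then have "(h, snd p) \<in> ?S"
      using p by auto
    moreover have "q = (h, snd p)" if "q \<in> ?S" for q
      using unique[of "(Suc (fst q), snd q)"] that h by (cases q) (auto simp: less_diff_conv)
    ultimately have "?S = {(h, snd p)}"
      by blast
    then have "card ?S = card {(h, snd p)}"
      by (rule arg_cong)
    then show ?thesis
      unfolding conc using False by (simp del: card_SigmaI)
  qed
qed

lemma rectangular_design_blocks:
  "rectangular_design (m * n) (n * (n - 1)) (n - 1) m 0 0 1 m n blocks"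
  unfolding rectangular_design_def
proof (intro conjI ballI impI)
  show "card (treatments m n) = m * n"
    by (simp add: treatments_def)
  show "size blocks = n * (n - 1)"
    using size_filter_blocks[of "\<lambda>_. True"] by simp
next
  fix B assume "B \<in># blocks"
  then obtain h j where B: "B = block (Suc h) j" "h < n - 1" "j < n"
    by (auto simp: blocks_def row_class_def set_mset_sum)
  then show "B \<subseteq> treatments m n"
    using entry_less by (auto simp: block_def treatments_def)
  show "card B = m"
    by (simp add: B card_block)
next
  fix x assume "x \<in> treatments m n"
  then show "replication blocks x = n - 1"
    by (rule replication_blocks)
next
  fix x y assume "x \<in> treatments m n" "y \<in> treatments m n" "x \<noteq> y"
  then show "concurrence blocks x y = (if fst x = fst y then 0 else if snd x = snd y then 0 else 1)"
    using concurrence_same_row[of "snd x" "snd y" "fst x"]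
      concurrence_other_row[of "fst x" "fst y" "snd x" "snd y"]
    by (cases x; cases y) (auto simp: treatments_def)
qed

section \<open>Semi-regularity\<close>

text \<open>The classical bound \<open>m \<le> n - 1\<close>, by pigeonhole on the
  \<open>n - 1\<close> nonzero symbols.\<close>

lemma less_order: "m < n"
proof -
  have "inj_on (\<lambda>l. f l 1 0) {..<m}"
  proof (rule inj_onI, rule ccontr)
    fix l l' assume l: "l \<in> {..<m}" "l' \<in> {..<m}" and eq: "f l 1 0 = f l' 1 0" and "l \<noteq> l'"
    have "f l 1 0 < n"
      using entry_less l two_le by simp
    \<comment> \<open>If two squares agreed in the cell \<open>(1, 0)\<close>, their pair of equal
      symbols would occur there and again in row 0.\<close>
    moreover from this have "f l 0 (f l 1 0) = f l 1 0" "f l' 0 (f l 1 0) = f l 1 0"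
      using first_row l by auto
    moreover obtain p where "\<And>q. fst q < n \<and> snd q < n \<and> f l (fst q) (snd q) = f l 1 0 \<and>
        f l' (fst q) (snd q) = f l 1 0 \<Longrightarrow> q = p"
      using orthogonal[of l l' "f l 1 0" "f l 1 0"] l \<open>l \<noteq> l'\<close> calculation(1) by blast
    from this[of "(1, 0)"] this[of "(0, f l 1 0)"] have "(1, 0) = (0::nat, f l 1 0)"
      using eq calculation two_le by simp
    then show False by simp
  qed
  moreover have "(\<lambda>l. f l 1 0) ` {..<m} \<subseteq> {1..<n}"
  proof
    fix c assume "c \<in> (\<lambda>l. f l 1 0) ` {..<m}"
    then obtain l where l: "l < m" "c = f l 1 0" by auto
    have "c \<noteq> 0"
    proof
      assume "c = 0"
      \<comment> \<open>Column 0 already has its symbol 0 in row 0.\<close>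
      then have "1 < n \<and> f l 1 0 = 0" "0 < n \<and> f l 0 0 = 0"
        using l two_le first_row by auto
      then have "(1::nat) = 0"
        using column_latin[of l 0 0] l(1) by blast
      then show False by simp
    qed
    then show "c \<in> {1..<n}"
      using l entry_less[of l 1 0] two_le by simp
  qed
  ultimately have "card {..<m} \<le> card {1..<n}"
    by (intro card_inj_on_le) auto
  then show ?thesis
    using two_le by simp
qed

text \<open>Here \<open>theta1\<close>, \<open>theta2\<close>, \<open>theta3\<close> evaluate to
  \<open>n - m\<close>, \<open>0\<close> and \<open>n\<close>.\<close>

lemma semi_regular_parameters: "semi_regular (n - 1) 0 0 1 m n"
  using less_order by (simp add: semi_regular_def theta1_def theta2_def theta3_def)

section \<open>Block order and resolution classes\<close>

text \<open>With the blocks listed row by row, submatrix \<open>(g, h)\<close> is the permutation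
  matrix of row \<open>Suc h\<close> of square \<open>g\<close>.\<close>

lemma STD_blocks: "STD m n blocks"
proof -
  define bs where "bs = map (\<lambda>q. block (Suc (q div n)) (q mod n)) [0..<(n - 1) * n]"
  have "mset bs = blocks"
    unfolding bs_def blocks_def row_class_def by (rule mset_map_div_mod)
  moreover have "n dvd length bs"
    by (simp add: bs_def)
  moreover have "constant_row_sums n (submatrix n (incidence_matrix n bs) g h) \<and>
      constant_column_sums n (submatrix n (incidence_matrix n bs) g h)"
    if g: "g < m" and "h < length bs div n" for g h
  proof -
    have h: "h < n - 1"
      using that two_le by (simp add: bs_def)
    have entry: "submatrix n (incidence_matrix n bs) g h s t = of_bool (f g (Suc h) t = s)"
      if "s < n" "t < n" for s t
    proof -
      \<comment> \<open>This keeps the index inside \<open>bs\<close>, where \<open>nth\<close> of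
        the mapped list can be evaluated.\<close>
      have "h * n + t < Suc h * n"
        using that by simp
      also have "\<dots> \<le> (n - 1) * n"
        using h by (intro mult_le_mono1) simp
      finally show ?thesis
        using that g by (simp add: submatrix_def incidence_matrix_def bs_def mem_block_iff)
    qed
    have "(\<Sum>t<n. submatrix n (incidence_matrix n bs) g h s t) = 1" if "s < n" for s
    proof -
      have "(\<Sum>t<n. submatrix n (incidence_matrix n bs) g h s t) =
          (\<Sum>t<n. of_bool (f g (Suc h) t = s))"
        using entry that by simp
      also have "\<dots> = card {t. t < n \<and> f g (Suc h) t = s}"
        by (simp add: Int_def)
      also have "\<dots> = 1"
        using card_row_entry g h that by simp
      finally show ?thesis .
    qed
    \<comment> \<open>The single 1 of column \<open>t\<close> stands in row
      \<open>f g (Suc h) t\<close>, which \<open>entry_less\<close> places inside the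
      submatrix.\<close>
    moreover have "(\<Sum>s<n. submatrix n (incidence_matrix n bs) g h s t) = 1" if "t < n" for t
      using entry that entry_less[of g "Suc h" t] g h by (simp add: of_bool_def)
    ultimately show ?thesis
      unfolding constant_row_sums_def constant_column_sums_def by blast
  qed
  ultimately show ?thesis
    unfolding STD_def by blast
qed

lemma resolvable_blocks: "resolvable m n blocks"
  unfolding resolvable_def
proof (intro exI conjI ballI)
  let ?\<C> = "image_mset (\<lambda>h. row_class (Suc h)) (mset_set {..<n - 1})"
  show "sum_mset ?\<C> = blocks"
    by (simp add: blocks_def sum_unfold_sum_mset)
  fix C assume "C \<in># ?\<C>"
  then obtain h where C: "C = row_class (Suc h)" "Suc h < n"
    by auto
  \<comment> \<open>This does not follow from replication 1, which is vacuous for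
    \<open>m = 0\<close>; it holds since a row has \<open>n > 0\<close> cells.\<close>
  then show "C \<noteq> {#}"
    by (auto simp: row_class_def mset_set_empty_iff)
  show "replication C x = 1" if "x \<in> treatments m n" for x
    using replication_row_class that C by simp
qed

end

theorem theorem7:
  fixes m n :: nat
  assumes "n \<ge> 2"
    and "\<exists>L :: nat \<Rightarrow> nat \<Rightarrow> nat \<Rightarrow> 'a. mols m n L"
  shows "\<exists>\<B>. rectangular_design (m * n) (n * (n - 1)) (n - 1) m 0 0 1 m n \<B> \<and>
           semi_regular (n - 1) 0 0 1 m n \<and>
           STD m n \<B> \<and>
           resolvable m n \<B>"
proof -
  obtain f where "normalised_mols m n f"
    using assms mols_normalise by blast
  then interpret normalised_mols m n f .
  show ?thesis
    using rectangular_design_blocks semi_regular_parameters STD_blocks resolvable_blocks by blast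
qed

end
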